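(* Let $r\ge 2$ and $h\ge 1$ be integers and let $T$ be the perfect $r$-ary tree with $h$ levels. For any integer $k\ge 1$, any vertex $v\in V(T)$, and any leaf $\ell$ of $T$, we have $|\mathcal{I}_T^k(v)|\le |\mathcal{I}_T^k(\ell)|$.
   Context: For an integer $r\ge 2$, the perfect $r$-ary tree with $h$ levels is the rooted tree in which every non-leaf vertex has exactly $r$ children and which has exactly $r^{h-1}$ leaves, all at distance $h-1$ from the root. Its leaves are the vertices at distance $h-1$ from the root. For a graph $G$, a set $I\subseteq V(G)$ is independent if no two vertices of $I$ are adjacent; $\mathcal{I}_G^k$ denotes the family of all independent sets of size $k$ in $G$, and for $v\in V(G)$, $\mathcal{I}_G^k(v)=\{A\in\mathcal{I}_G^k : v\in A\}$ (the star with centre $v$). *)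

theory Defs
  imports "Graph_Theory.Graph_Theory"
begin

text \<open>
  Finite simple undirected graphs are the symmetric digraphs of the locale \<^locale>\<open>graph\<close>.
  The library constant \<^const>\<open>forest\<close> is of no use for them: in a symmetric digraph every edge
  yields a directed cycle of length 2. A cycle of the undirected graph is a directed
  cycle of length at least 3.
\<close>
definition undirected_tree :: "('a, 'b) pre_digraph \<Rightarrow> bool" where
  "undirected_tree G \<longleftrightarrow>
     graph G \<and> connected G \<and> \<not> (\<exists>p. pre_digraph.cycle G p \<and> length p \<ge> 3)"

definition hop_dist :: "('a, 'b) pre_digraph \<Rightarrow> 'a \<Rightarrow> 'a \<Rightarrow> ereal" where
  "hop_dist G u v = wf_digraph.\<mu> G (\<lambda>_. 1) u v"

definition children :: "('a, 'b) pre_digraph \<Rightarrow> 'a \<Rightarrow> 'a \<Rightarrow> 'a set" where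
  "children G rt v =
     {u \<in> verts G. v \<rightarrow>\<^bsub>G\<^esub> u \<and> hop_dist G rt u = hop_dist G rt v + 1}"

text \<open>Leaves of a rooted tree are the childless vertices, so a lone root is a leaf.\<close>
definition leaves :: "('a, 'b) pre_digraph \<Rightarrow> 'a \<Rightarrow> 'a set" where
  "leaves G rt = {v \<in> verts G. children G rt v = {}}"

definition perfect_tree :: "nat \<Rightarrow> nat \<Rightarrow> ('a, 'b) pre_digraph \<Rightarrow> 'a \<Rightarrow> bool" where
  "perfect_tree r h G rt \<longleftrightarrow>
     undirected_tree G \<and> rt \<in> verts G \<and>
     (\<forall>v \<in> verts G - leaves G rt. card (children G rt v) = r) \<and>
     card (leaves G rt) = r ^ (h - 1) \<and>
     (\<forall>l \<in> leaves G rt. hop_dist G rt l = ereal (real (h - 1)))"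

definition independent_set :: "('a, 'b) pre_digraph \<Rightarrow> 'a set \<Rightarrow> bool" where
  "independent_set G A \<longleftrightarrow> A \<subseteq> verts G \<and> (\<forall>u \<in> A. \<forall>v \<in> A. \<not> u \<rightarrow>\<^bsub>G\<^esub> v)"

definition indep_sets_of_size :: "('a, 'b) pre_digraph \<Rightarrow> nat \<Rightarrow> 'a set set" where
  "indep_sets_of_size G k = {A. independent_set G A \<and> card A = k}"

definition indep_star :: "('a, 'b) pre_digraph \<Rightarrow> nat \<Rightarrow> 'a \<Rightarrow> 'a set set" where
  "indep_star G k v = {A \<in> indep_sets_of_size G k. v \<in> A}"

end

theory Submission
  imports Defs "HOL-Computational_Algebra.Polynomial"
begin

text \<open>
  Let \<open>v = u\<^sub>j, \<dots>, u\<^sub>1, u\<^sub>0 = l\<close> be a path from \<open>v\<close> down to a leaf below it. Cutting the edges of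
  this path splits the tree into pieces \<open>H\<^sub>0, \<dots>, H\<^sub>j\<close>, and the independent sets are counted by
  transfer along the chain, where \<open>a\<^sub>i\<close> and \<open>b\<^sub>i\<close> are the generating polynomials of the independent
  sets of \<open>H\<^sub>i\<close> without and with \<open>u\<^sub>i\<close>. Peeling the chain from both ends at once, the difference of
  the stars at \<open>l\<close> and \<open>v\<close> is seen to have nonnegative coefficients, provided that
  \<open>a\<^sub>i b\<^sub>k - a\<^sub>k b\<^sub>i\<close> for \<open>i \<le> k = j - i\<close> has the sign of \<open>(-1)\<^sup>i\<^sup>-\<^sup>1\<close>. This sign condition holds
  because the odds of the root of a perfect tree of height \<open>m\<close> being occupied are
  \<open>\<rho>\<^sub>m = x / (1 + \<rho>\<^sub>m\<^sub>-\<^sub>1)\<^sup>r\<close>, so that comparisons between heights \<open>m < n\<close> reverse when both drop by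
  one, down to \<open>\<rho>\<^sub>0 = x\<close>, which is the largest. Taking \<open>v\<close> to be the root, the same transfer shows
  that the star at a leaf does not depend on the leaf.
\<close>

section \<open>Coefficientwise nonnegative polynomials\<close>

text \<open>The order behind all comparisons: for generating polynomials, nonnegativity of a
  difference is the inequality of counts for every size \<open>k\<close> at once.\<close>

definition nonneg_poly :: "int poly \<Rightarrow> bool" where
  "nonneg_poly p \<longleftrightarrow> (\<forall>n. 0 \<le> coeff p n)"

lemma nonneg_poly_add: "nonneg_poly p \<Longrightarrow> nonneg_poly q \<Longrightarrow> nonneg_poly (p + q)"
  by (simp add: nonneg_poly_def)

lemma nonneg_poly_mult: "nonneg_poly p \<Longrightarrow> nonneg_poly q \<Longrightarrow> nonneg_poly (p * q)"
  by (simp add: nonneg_poly_def coeff_mult sum_nonneg)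

lemma nonneg_poly_0 [simp]: "nonneg_poly 0" and nonneg_poly_1 [simp]: "nonneg_poly 1"
  by (simp_all add: nonneg_poly_def)

lemma nonneg_poly_monom: "c \<ge> 0 \<Longrightarrow> nonneg_poly (monom c n)"
  by (simp add: nonneg_poly_def)

lemma nonneg_poly_power: "nonneg_poly p \<Longrightarrow> nonneg_poly (p ^ n)"
  by (induction n) (auto intro: nonneg_poly_mult)

lemma nonneg_poly_sum: "(\<And>i. i \<in> A \<Longrightarrow> nonneg_poly (f i)) \<Longrightarrow> nonneg_poly (sum f A)"
  by (induction A rule: infinite_finite_induct) (auto intro: nonneg_poly_add)

lemma nonneg_poly_mult_mono:
  assumes "nonneg_poly (p' - p)" "nonneg_poly (q' - q)" "nonneg_poly p'" "nonneg_poly q"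
  shows "nonneg_poly (p' * q' - p * q)"
proof -
  have "p' * q' - p * q = p' * (q' - q) + (p' - p) * q" by (simp add: algebra_simps)
  then show ?thesis using assms by (simp add: nonneg_poly_add nonneg_poly_mult)
qed

lemma nonneg_poly_power_mono:
  assumes "nonneg_poly (q - p)" "nonneg_poly p" "nonneg_poly q"
  shows "nonneg_poly (q ^ n - p ^ n)"
  by (induction n) (simp_all add: assms nonneg_poly_mult_mono nonneg_poly_power)

text \<open>Independent sets of the perfect tree of height \<open>n\<close> that avoid, respectively contain, its root.\<close>
fun out_poly in_poly :: "nat \<Rightarrow> nat \<Rightarrow> int poly" where
  "out_poly r 0 = 1"
| "in_poly r 0 = monom 1 1"
| "out_poly r (Suc n) = (out_poly r n + in_poly r n) ^ r"
| "in_poly r (Suc n) = monom 1 1 * out_poly r n ^ r"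

lemma nonneg_out_in_poly: "nonneg_poly (out_poly r n) \<and> nonneg_poly (in_poly r n)"
  by (induction n) (auto intro!: nonneg_poly_add nonneg_poly_mult nonneg_poly_power nonneg_poly_monom)

lemmas nonneg_out_poly = nonneg_out_in_poly [THEN conjunct1]
lemmas nonneg_in_poly = nonneg_out_in_poly [THEN conjunct2]

text \<open>With the odds \<open>rho_j = in_poly r j / out_poly r j\<close>, clearing denominators
  turns this into a comparison of \<open>(1 + rho_m)^k\<close> with \<open>(1 + rho_n)^k\<close>.
  The recursion \<open>rho_(j+1) = x / (1 + rho_j)^r\<close> reverses the order, whence the sign
  \<open>(- 1) ^ m\<close>, and no odds exceed \<open>rho_0 = x\<close>.\<close>

lemma root_odds_alternate:
  assumes "m \<le> n"
  shows "nonneg_poly ((- 1) ^ m *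
    ((out_poly r m + in_poly r m) ^ k * out_poly r n ^ k
      - (out_poly r n + in_poly r n) ^ k * out_poly r m ^ k))"
  using assms
proof (induction m arbitrary: n k)
  case 0
  have "nonneg_poly ((1 + monom 1 1) * out_poly r n - (out_poly r n + in_poly r n))"
  proof (cases n)
    case (Suc i)
    have "nonneg_poly ((out_poly r i + in_poly r i) ^ r - out_poly r i ^ r)"
      by (intro nonneg_poly_power_mono) (auto intro: nonneg_poly_add nonneg_out_poly nonneg_in_poly)
    then have "nonneg_poly (monom 1 1 * ((out_poly r i + in_poly r i) ^ r - out_poly r i ^ r))"
      by (intro nonneg_poly_mult nonneg_poly_monom) auto
    then show ?thesis using Suc by (simp add: algebra_simps)
  qed simp
  then have "nonneg_poly (((1 + monom 1 1) * out_poly r n) ^ k - (out_poly r n + in_poly r n) ^ k)"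
    by (intro nonneg_poly_power_mono)
      (auto intro!: nonneg_poly_add nonneg_poly_mult nonneg_out_poly nonneg_in_poly nonneg_poly_monom)
  then show ?case by (simp add: power_mult_distrib)
next
  case (Suc m)
  then obtain i where i: "n = Suc i" "m \<le> i" by (cases n) auto
  define f where "f j = out_poly r j + in_poly r j" for j
  have f: "nonneg_poly (f j)" for j
    unfolding f_def by (intro nonneg_poly_add nonneg_out_poly nonneg_in_poly)
  \<comment> \<open>The induction hypothesis is taken with \<open>k = r\<close>. One step of the
    recursion turns it into the claim for exponent 1 with the opposite sign, which is then raised to
    the power \<open>k\<close>.\<close>
  have "nonneg_poly ((- 1) ^ m * (f m ^ r * out_poly r i ^ r - f i ^ r * out_poly r m ^ r))"
    using Suc.IH [OF i(2)] by (simp add: f_def)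
  then have "nonneg_poly (monom 1 1 * ((- 1) ^ m * (f m ^ r * out_poly r i ^ r - f i ^ r * out_poly r m ^ r)))"
    using nonneg_poly_mult [OF nonneg_poly_monom [OF zero_le_one]] by blast
  also have "monom 1 1 * ((- 1) ^ m * (f m ^ r * out_poly r i ^ r - f i ^ r * out_poly r m ^ r))
      = (- 1) ^ Suc m * (f (Suc m) * out_poly r n - f n * out_poly r (Suc m))"
    by (simp add: i f_def [of "Suc _"] flip: f_def) (simp add: algebra_simps)
  finally have *: "nonneg_poly ((- 1) ^ Suc m * (f (Suc m) * out_poly r n - f n * out_poly r (Suc m)))" .
  have nn: "nonneg_poly (f j * out_poly r j')" for j j'
    by (intro nonneg_poly_mult f nonneg_out_poly)
  have "nonneg_poly ((- 1) ^ Suc m * ((f (Suc m) * out_poly r n) ^ k - (f n * out_poly r (Suc m)) ^ k))"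
  proof (cases "even (Suc m)")
    case True
    then show ?thesis using nonneg_poly_power_mono [OF _ nn nn] * by (simp del: out_poly.simps)
  next
    case False
    then show ?thesis using nonneg_poly_power_mono [OF _ nn nn] * by (simp del: out_poly.simps)
  qed
  then show ?case by (simp add: f_def power_mult_distrib)
qed

section \<open>Comparing the two ends of a chain\<close>

text \<open>Transfer along a path whose last vertex is free or occupied, two neighbours never being
  both occupied. Replacing \<open>a i\<close> by 0 keeps only the sets that occupy vertex
  \<open>i\<close>; this is how stars are expressed.\<close>

fun chain_out chain_in :: "(nat \<Rightarrow> 'a) \<Rightarrow> (nat \<Rightarrow> 'a) \<Rightarrow> nat \<Rightarrow> 'a::comm_ring_1" where
  "chain_out a b 0 = a 0"
| "chain_in a b 0 = b 0"
| "chain_out a b (Suc n) = a (Suc n) * (chain_out a b n + chain_in a b n)"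
| "chain_in a b (Suc n) = b (Suc n) * chain_out a b n"

lemma chain_out_in_cong:
  assumes "\<And>i. i \<le> n \<Longrightarrow> a i = a' i" "\<And>i. i \<le> n \<Longrightarrow> b i = b' i"
  shows "chain_out a b n = chain_out a' b' n \<and> chain_in a b n = chain_in a' b' n"
  using assms by (induction n) auto

text \<open>The reversed chain runs from \<open>j\<close> down to \<open>j - k = i + 1\<close>, and
  only the product with both ends of the cut edge occupied is missing. Raising \<open>k\<close> by
  one moves the cut one vertex to the left.\<close>

lemma chain_cut:
  assumes "i + k + 1 = j"
  shows "chain_out a b j + chain_in a b j =
    chain_out a b i * (chain_out (\<lambda>k. a (j - k)) (\<lambda>k. b (j - k)) k
                     + chain_in (\<lambda>k. a (j - k)) (\<lambda>k. b (j - k)) k)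
    + chain_in a b i * chain_out (\<lambda>k. a (j - k)) (\<lambda>k. b (j - k)) k"
  using assms
proof (induction k arbitrary: i)
  case 0
  then show ?case by (auto simp: algebra_simps)
next
  case (Suc k)
  have j: "j - Suc k = Suc i" using Suc.prems by simp
  show ?case using Suc.IH [of "Suc i"] Suc.prems by (simp add: j algebra_simps)
qed

text \<open>The chain is peeled simultaneously from both ends. The first index of \<open>D\<close> tells
  whether the left cut vertex is occupied, and the second whether the right one is. \<open>D False False\<close> and \<open>D True True\<close> stay
  nonnegative; of the two mixed differences one may be negative, but their sum never is, and the
  sign condition on \<open>a\<close> and \<open>b\<close> gives the nonnegative one the larger weight in each step.\<close>
lemma chain_ends_compare:
  fixes a b :: "nat \<Rightarrow> int poly"
  assumes j: "j > 0"
    and nn: "\<And>i. i \<le> j \<Longrightarrow> nonneg_poly (a i)" "\<And>i. i \<le> j \<Longrightarrow> nonneg_poly (b i)"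
    and ends: "nonneg_poly (b 0 * a j - a 0 * b j)"
    and alt: "\<And>i. Suc i \<le> j - Suc i \<Longrightarrow>
      nonneg_poly ((- 1) ^ i * (a (Suc i) * b (j - Suc i) - a (j - Suc i) * b (Suc i)))"
  shows "nonneg_poly ((chain_out (a(0 := 0)) b j + chain_in (a(0 := 0)) b j)
    - (chain_out (a(j := 0)) b j + chain_in (a(j := 0)) b j))"
proof -
  define rv where "rv f k = f (j - k)" for f :: "nat \<Rightarrow> int poly" and k
  \<comment> \<open>\<open>lf\<close> forces vertex 0 to be occupied and \<open>tp\<close> forces
    vertex \<open>j\<close>. Below, \<open>D s t i\<close> compares the two on the pieces
    \<open>0..i\<close> and \<open>j - i..j\<close> only.\<close>
  define lf tp where "lf = a(0 := 0)" and "tp = a(j := 0)"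
  define sel :: "bool \<Rightarrow> (nat \<Rightarrow> int poly) \<Rightarrow> (nat \<Rightarrow> int poly) \<Rightarrow> nat \<Rightarrow> int poly"
    where "sel s = (if s then chain_in else chain_out)" for s
  define D where "D s t i = sel s lf b i * sel t (rv lf) (rv b) i - sel s tp b i * sel t (rv tp) (rv b) i"
    for s t i
  have D0: "D False False 0 = 0" "D True True 0 = 0"
    "D False True 0 = - (a 0 * b j)" "D True False 0 = b 0 * a j"
    using j by (simp_all add: D_def sel_def lf_def tp_def rv_def algebra_simps)
  have DS: "D False False (Suc i) =
        a (Suc i) * a (j - Suc i) * (D False False i + D False True i + D True False i + D True True i)"
      "D False True (Suc i) = a (Suc i) * b (j - Suc i) * (D False False i + D True False i)"
      "D True False (Suc i) = a (j - Suc i) * b (Suc i) * (D False False i + D False True i)"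
      "D True True (Suc i) = b (Suc i) * b (j - Suc i) * D False False i"
    if "Suc i < j" for i
    using that by (simp_all add: D_def sel_def lf_def tp_def rv_def algebra_simps)
  have inv: "nonneg_poly (D False False i) \<and> nonneg_poly (D True True i)
      \<and> nonneg_poly (D False True i + D True False i)
      \<and> nonneg_poly (if even i then D True False i else D False True i)" if "2 * i < j" for i
    using that
  proof (induction i)
    case 0
    show ?case using ends nn j by (simp add: D0 nonneg_poly_mult)
  next
    case (Suc i)
    then have i: "Suc i < j" "Suc i \<le> j - Suc i" by auto
    define A A' B B' where "A = a (Suc i)" and "A' = a (j - Suc i)" and "B = b (Suc i)" and "B' = b (j - Suc i)"
    have nn': "nonneg_poly A" "nonneg_poly A'" "nonneg_poly B" "nonneg_poly B'"
      using nn i by (auto simp: A_def A'_def B_def B'_def)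
    note DS = DS [OF i(1), folded A_def A'_def B_def B'_def]
    from Suc have IH: "nonneg_poly (D False False i)" "nonneg_poly (D True True i)"
      "nonneg_poly (D False True i + D True False i)"
      "nonneg_poly (if even i then D True False i else D False True i)" by auto
    have "nonneg_poly (D False False i + (D False True i + D True False i) + D True True i)"
      by (intro nonneg_poly_add IH)
    then have 1: "nonneg_poly (D False False (Suc i))"
      unfolding DS(1) by (intro nonneg_poly_mult nn') (simp add: algebra_simps)
    have 2: "nonneg_poly (D True True (Suc i))"
      unfolding DS by (intro nonneg_poly_mult nn' IH)
    have s: "nonneg_poly ((- 1) ^ i * (A * B' - A' * B))"
      using alt [OF i(2)] by (simp add: A_def A'_def B_def B'_def)
    have 3: "nonneg_poly (D False True (Suc i) + D True False (Suc i))"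
    proof (cases "even i")
      case True
      have "D False True (Suc i) + D True False (Suc i) = (A * B' + A' * B) * D False False i
          + (A * B' - A' * B) * D True False i + A' * B * (D False True i + D True False i)"
        unfolding DS by (simp add: algebra_simps)
      moreover have "nonneg_poly \<dots>"
        using IH s True
        by (intro nonneg_poly_add [OF nonneg_poly_add] nonneg_poly_mult [OF _ IH(3)]
            nonneg_poly_mult nonneg_poly_add [OF nonneg_poly_mult nonneg_poly_mult] nn') auto
      ultimately show ?thesis by simp
    next
      case False
      have "D False True (Suc i) + D True False (Suc i) = (A * B' + A' * B) * D False False i
          + (A' * B - A * B') * D False True i + A * B' * (D False True i + D True False i)"
        unfolding DS by (simp add: algebra_simps)
      moreover have "nonneg_poly \<dots>"
        using IH s False
        by (intro nonneg_poly_add [OF nonneg_poly_add] nonneg_poly_mult [OF _ IH(3)]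
            nonneg_poly_mult nonneg_poly_add [OF nonneg_poly_mult nonneg_poly_mult] nn') auto
      ultimately show ?thesis by simp
    qed
    \<comment> \<open>Each mixed difference is fed by the opposite one of the previous step, so the
      one known to be nonnegative alternates.\<close>
    have 4: "nonneg_poly (if even (Suc i) then D True False (Suc i) else D False True (Suc i))"
      using IH unfolding DS by (auto intro!: nonneg_poly_add nonneg_poly_mult nn' split: if_splits)
    show ?case using 1 2 3 4 by blast
  qed
  define d where "d = (chain_out lf b j + chain_in lf b j) - (chain_out tp b j + chain_in tp b j)"
  have cut: "chain_out c b j + chain_in c b j = chain_out c b i
      * (chain_out (rv c) (rv b) k + chain_in (rv c) (rv b) k) + chain_in c b i * chain_out (rv c) (rv b) k"
    if "i + k + 1 = j" for c i k
    using chain_cut [OF that, of c b] by (simp add: rv_def [abs_def])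
  \<comment> \<open>Both halves have \<open>s + 1\<close> vertices. For odd \<open>j\<close> they
    meet along an edge, which excludes only \<open>D True True\<close>. For even \<open>j\<close>
    the vertex \<open>Suc s\<close> remains between them: if free, it admits all four states of its
    neighbours, and if occupied, only \<open>D False False\<close>.\<close>
  define s where "s = (j - 1) div 2"
  have s: "2 * s < j" using j by (simp add: s_def)
  note I = inv [OF s]
  have "nonneg_poly d"
  proof (cases "odd j")
    case True
    then have "s + s + 1 = j" unfolding s_def by presburger
    then have "d = D False False s + (D False True s + D True False s)"
      unfolding d_def by (simp add: cut D_def sel_def) (simp add: algebra_simps)
    then show ?thesis using I by (simp add: nonneg_poly_add)
  next
    case False
    then have e: "s + Suc s + 1 = j" unfolding s_def using j by presburger
    then have m: "j - Suc s = Suc s" "Suc s < j" by auto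
    have "d = a (Suc s) * (D False False s + (D False True s + D True False s) + D True True s)
        + b (Suc s) * D False False s"
      unfolding d_def cut [OF e] using m
      by (simp add: D_def sel_def) (simp add: rv_def lf_def tp_def algebra_simps)
    moreover have "nonneg_poly \<dots>"
      using I nn m by (intro nonneg_poly_add [OF nonneg_poly_mult nonneg_poly_mult]
          nonneg_poly_add [OF nonneg_poly_add]) auto
    ultimately show ?thesis by simp
  qed
  then show ?thesis by (simp add: d_def lf_def tp_def)
qed

section \<open>Generating polynomials of independent sets\<close>

definition set_poly :: "'a set set \<Rightarrow> int poly" where
  "set_poly F = (\<Sum>A\<in>F. monom 1 (card A))"

lemma coeff_set_poly:
  assumes "finite F"
  shows "coeff (set_poly F) k = int (card {A \<in> F. card A = k})"
proof -
  have "coeff (set_poly F) k = (\<Sum>A\<in>F. if card A = k then 1 else 0)"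
    by (simp add: set_poly_def coeff_sum eq_commute)
  also have "\<dots> = int (card {A \<in> F. card A = k})"
    using assms by (simp add: sum.If_cases Int_def)
  finally show ?thesis .
qed

lemma nonneg_set_poly: "nonneg_poly (set_poly F)"
  unfolding set_poly_def by (intro nonneg_poly_sum nonneg_poly_monom) auto

lemma set_poly_Un_disjoint:
  "finite F \<Longrightarrow> finite G \<Longrightarrow> F \<inter> G = {} \<Longrightarrow> set_poly (F \<union> G) = set_poly F + set_poly G"
  by (simp add: set_poly_def sum.union_disjoint)

text \<open>Splitting a set into its parts in \<open>S\<close> and \<open>T\<close> is a bijection
  from \<open>K\<close> to pairs, and sizes add.\<close>

lemma set_poly_product:
  assumes fin: "finite S" "finite T" and disj: "S \<inter> T = {}"
    and F: "F \<subseteq> Pow S" and G: "G \<subseteq> Pow T"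
    and K: "K = {A. A \<subseteq> S \<union> T \<and> A \<inter> S \<in> F \<and> A \<inter> T \<in> G}"
  shows "set_poly K = set_poly F * set_poly G"
proof -
  have "set_poly F * set_poly G = (\<Sum>(A, B)\<in>F \<times> G. monom 1 (card A) * monom 1 (card B))"
    by (simp add: set_poly_def sum_product sum.cartesian_product)
  also have "\<dots> = (\<Sum>C\<in>K. monom 1 (card C))"
  proof (rule sum.reindex_bij_witness [where i = "\<lambda>C. (C \<inter> S, C \<inter> T)" and j = "\<lambda>(A, B). A \<union> B"])
    fix p assume "p \<in> F \<times> G"
    then obtain A B where p: "p = (A, B)" "A \<in> F" "B \<in> G" by auto
    then have AB: "A \<subseteq> S" "B \<subseteq> T" using F G by auto
    then have I: "(A \<union> B) \<inter> S = A" "(A \<union> B) \<inter> T = B" using disj by auto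
    show "((case p of (A, B) \<Rightarrow> A \<union> B) \<inter> S, (case p of (A, B) \<Rightarrow> A \<union> B) \<inter> T) = p"
      using p I by simp
    show "(case p of (A, B) \<Rightarrow> A \<union> B) \<in> K"
      using p I AB by (auto simp: K)
    have "card (A \<union> B) = card A + card B"
      using AB fin disj by (intro card_Un_disjoint) (auto intro: finite_subset)
    then show "monom 1 (card (case p of (A, B) \<Rightarrow> A \<union> B))
        = (case p of (A, B) \<Rightarrow> monom (1::int) (card A) * monom 1 (card B))"
      using p by (simp add: mult_monom)
  qed (auto simp: K)
  finally show ?thesis by (simp add: set_poly_def)
qed

section \<open>Independent sets of a finite graph, split at a vertex and glued along an edge\<close>

locale finite_simple_graph =
  fixes V :: "'a set" and E :: "'a \<Rightarrow> 'a \<Rightarrow> bool"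
  assumes finite_V: "finite V"
    and E_sym: "E u v \<Longrightarrow> E v u"
    and E_irrefl: "\<not> E u u"
    and E_in_V: "E u v \<Longrightarrow> u \<in> V"
begin

definition indep :: "'a set \<Rightarrow> 'a set set" where
  "indep S = {A. A \<subseteq> S \<and> (\<forall>u\<in>A. \<forall>v\<in>A. \<not> E u v)}"

text \<open>\<open>F\<close> holds prescribed members: it is empty when all independent sets are
  counted, and a singleton for a star. The vertex \<open>u\<close> is where the piece
  \<open>S\<close> is attached to the rest of the graph.\<close>

definition without_poly :: "'a set \<Rightarrow> 'a set \<Rightarrow> 'a \<Rightarrow> int poly" where
  "without_poly F S u = set_poly {A \<in> indep S. F \<subseteq> A \<and> u \<notin> A}"

definition with_poly :: "'a set \<Rightarrow> 'a set \<Rightarrow> 'a \<Rightarrow> int poly" where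
  "with_poly F S u = set_poly {A \<in> indep S. F \<subseteq> A \<and> u \<in> A}"

lemma finite_indep: "S \<subseteq> V \<Longrightarrow> finite (indep S)"
  by (rule finite_subset [of _ "Pow V"]) (auto simp: indep_def finite_V)

lemma without_plus_with:
  assumes "S \<subseteq> V"
  shows "without_poly F S u + with_poly F S u = set_poly {A \<in> indep S. F \<subseteq> A}"
  unfolding without_poly_def with_poly_def
  by (subst set_poly_Un_disjoint [symmetric])
    (auto simp: finite_indep [OF assms] intro!: arg_cong [where f = set_poly])

lemma indep_Un_iff:
  assumes "\<And>x y. x \<in> S \<Longrightarrow> y \<in> T \<Longrightarrow> E x y \<longleftrightarrow> x = s \<and> y = t" "A \<subseteq> S \<union> T"
  shows "A \<in> indep (S \<union> T) \<longleftrightarrow> A \<inter> S \<in> indep S \<and> A \<inter> T \<in> indep T \<and> \<not> (s \<in> A \<inter> S \<and> t \<in> A \<inter> T)"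
proof
  assume "A \<in> indep (S \<union> T)"
  then show "A \<inter> S \<in> indep S \<and> A \<inter> T \<in> indep T \<and> \<not> (s \<in> A \<inter> S \<and> t \<in> A \<inter> T)"
    using assms(1) unfolding indep_def by blast
next
  assume r: "A \<inter> S \<in> indep S \<and> A \<inter> T \<in> indep T \<and> \<not> (s \<in> A \<inter> S \<and> t \<in> A \<inter> T)"
  have "\<not> E x y" if xy: "x \<in> A" "y \<in> A" for x y
  proof
    assume E: "E x y"
    consider "x \<in> S" "y \<in> S" | "x \<in> T" "y \<in> T" | "x \<in> S" "y \<in> T" | "x \<in> T" "y \<in> S"
      using xy assms(2) by blast
    then show False
    proof cases
      case 3 then show False using assms(1) [of x y] E r xy by blast
    next
      case 4 then show False using assms(1) [of y x] E_sym [OF E] r xy by blast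
    qed (use r E xy in \<open>auto simp: indep_def\<close>)
  qed
  then show "A \<in> indep (S \<union> T)" using assms(2) by (auto simp: indep_def)
qed

text \<open>As \<open>s\<close> and \<open>t\<close> span the only edge between \<open>S\<close> and
  \<open>T\<close>, the independent sets of the union are the pairs of independent sets that do not
  contain both \<open>s\<close> and \<open>t\<close>. This is one step of \<open>chain_out\<close>
  and \<open>chain_in\<close>.\<close>

lemma glue_along_edge:
  assumes S: "S \<subseteq> V" and T: "T \<subseteq> V" and disj: "S \<inter> T = {}" and F: "F \<subseteq> T"
    and st: "s \<in> S" "t \<in> T"
    and edge: "\<And>x y. x \<in> S \<Longrightarrow> y \<in> T \<Longrightarrow> E x y \<longleftrightarrow> x = s \<and> y = t"
  shows "without_poly F (S \<union> T) s = without_poly {} S s * (without_poly F T t + with_poly F T t)"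
    and "with_poly F (S \<union> T) s = with_poly {} S s * without_poly F T t"
proof -
  have fin: "finite S" "finite T" using S T finite_V finite_subset by blast+
  have sub: "A \<subseteq> S \<union> T" if "A \<in> indep (S \<union> T)" for A
    using that by (auto simp: indep_def)
  have FA: "F \<subseteq> A \<longleftrightarrow> F \<subseteq> A \<inter> T" and sA: "s \<in> A \<longleftrightarrow> s \<in> A \<inter> S" for A
    using F st by auto
  show "without_poly F (S \<union> T) s = without_poly {} S s * (without_poly F T t + with_poly F T t)"
    unfolding without_plus_with [OF T] unfolding without_poly_def
  proof (rule set_poly_product [OF fin disj])
    show "{A \<in> indep (S \<union> T). F \<subseteq> A \<and> s \<notin> A} = {A. A \<subseteq> S \<union> T
        \<and> A \<inter> S \<in> {A \<in> indep S. {} \<subseteq> A \<and> s \<notin> A} \<and> A \<inter> T \<in> {A \<in> indep T. F \<subseteq> A}}"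
      using indep_Un_iff [OF edge] sub FA sA by (intro Collect_cong) (smt (verit) empty_subsetI mem_Collect_eq)
  qed (auto simp: indep_def)
  show "with_poly F (S \<union> T) s = with_poly {} S s * without_poly F T t"
    unfolding with_poly_def without_poly_def
  proof (rule set_poly_product [OF fin disj])
    show "{A \<in> indep (S \<union> T). F \<subseteq> A \<and> s \<in> A} = {A. A \<subseteq> S \<union> T
        \<and> A \<inter> S \<in> {A \<in> indep S. {} \<subseteq> A \<and> s \<in> A} \<and> A \<inter> T \<in> {A \<in> indep T. F \<subseteq> A \<and> t \<notin> A}}"
      using indep_Un_iff [OF edge] sub FA sA by (intro Collect_cong) (smt (verit) empty_subsetI mem_Collect_eq)
  qed (auto simp: indep_def)
qed

lemma without_with_singleton:
  assumes "u \<in> V"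
  shows "without_poly {} {u} u = 1" "with_poly {} {u} u = monom 1 1"
    "without_poly {u} {u} u = 0" "with_poly {u} {u} u = monom 1 1"
proof -
  have i: "indep {u} = {{}, {u}}" using E_irrefl by (auto simp: indep_def)
  have *: "{A \<in> indep {u}. {} \<subseteq> A \<and> u \<notin> A} = {{}}" "{A \<in> indep {u}. {} \<subseteq> A \<and> u \<in> A} = {{u}}"
    "{A \<in> indep {u}. {u} \<subseteq> A \<and> u \<notin> A} = {}" "{A \<in> indep {u}. {u} \<subseteq> A \<and> u \<in> A} = {{u}}"
    unfolding i by auto
  show "without_poly {} {u} u = 1" "with_poly {} {u} u = monom 1 1"
    "without_poly {u} {u} u = 0" "with_poly {u} {u} u = monom 1 1"
    unfolding without_poly_def with_poly_def * by (simp_all add: set_poly_def)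
qed

text \<open>Deleting \<open>u\<close> maps the independent sets with \<open>u\<close> injectively to
  those without it and lowers the size by one.\<close>

lemma with_le_without:
  assumes "S \<subseteq> V"
  shows "nonneg_poly (monom 1 1 * without_poly {} S u - with_poly {} S u)"
proof -
  let ?I = "{A \<in> indep S. u \<in> A}" and ?O = "{A \<in> indep S. u \<notin> A}" and ?f = "\<lambda>A. A - {u}"
  have fin: "finite ?I" "finite ?O" using finite_indep [OF assms] by auto
  have inj: "inj_on ?f ?I" by (auto simp: inj_on_def)
  have sub: "?f ` ?I \<subseteq> ?O" by (auto simp: indep_def)
  have "monom 1 (card A) = monom 1 1 * monom (1::int) (card (?f A))" if "A \<in> ?I" for A
  proof -
    have "finite A" using that assms finite_V by (auto simp: indep_def intro: finite_subset)
    then have "card A = Suc (card (?f A))" using that card_Suc_Diff1 [of A u] by simp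
    then show ?thesis by (simp add: mult_monom)
  qed
  then have "set_poly ?I = (\<Sum>A\<in>?I. monom 1 1 * monom (1::int) (card (?f A)))"
    unfolding set_poly_def by (intro sum.cong refl)
  also have "\<dots> = monom 1 1 * set_poly (?f ` ?I)"
    unfolding set_poly_def by (simp only: sum.reindex [OF inj] o_def sum_distrib_left)
  finally have I: "set_poly ?I = monom 1 1 * set_poly (?f ` ?I)" .
  have "set_poly ?O = set_poly (?f ` ?I \<union> (?O - ?f ` ?I))"
    using sub by (simp add: Un_absorb1)
  also have "\<dots> = set_poly (?f ` ?I) + set_poly (?O - ?f ` ?I)"
    using fin by (intro set_poly_Un_disjoint) auto
  finally have "monom 1 1 * without_poly {} S u - with_poly {} S u = monom 1 1 * set_poly (?O - ?f ` ?I)"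
    using I by (simp add: without_poly_def with_poly_def algebra_simps)
  then show ?thesis by (simp add: nonneg_poly_mult nonneg_poly_monom nonneg_set_poly)
qed

end

section \<open>Perfect trees\<close>

text \<open>Rooted trees are described by a level function, so that parents and subtrees can be
  treated without walks.\<close>

locale levelled_tree = finite_simple_graph V E for V :: "'a set" and E :: "'a \<Rightarrow> 'a \<Rightarrow> bool" +
  fixes lev :: "'a \<Rightarrow> nat" and rt :: 'a
  assumes E_lev: "E u v \<Longrightarrow> lev u = Suc (lev v) \<or> lev v = Suc (lev u)"
    and parent_unique: "E u w \<Longrightarrow> E v w \<Longrightarrow> lev w = Suc (lev u) \<Longrightarrow> lev w = Suc (lev v) \<Longrightarrow> u = v"
    and rt_in_V: "rt \<in> V"
    and lev_rt: "lev rt = 0"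
    and has_parent: "v \<in> V \<Longrightarrow> v \<noteq> rt \<Longrightarrow> \<exists>u. E u v \<and> lev v = Suc (lev u)"
begin

definition child :: "'a \<Rightarrow> 'a \<Rightarrow> bool" where
  "child u v \<longleftrightarrow> E u v \<and> lev v = Suc (lev u)"

definition desc :: "'a \<Rightarrow> 'a set" where
  "desc u = {w. child\<^sup>*\<^sup>* u w}"

lemma child_parent_unique: "child u w \<Longrightarrow> child v w \<Longrightarrow> u = v"
  using parent_unique by (auto simp: child_def)

lemma child_in_V: "child u v \<Longrightarrow> u \<in> V \<and> v \<in> V"
  using E_in_V E_sym by (auto simp: child_def)

lemma self_in_desc [simp]: "u \<in> desc u"
  by (simp add: desc_def)

lemma desc_child: "w \<in> desc u \<Longrightarrow> child w z \<Longrightarrow> z \<in> desc u"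
  by (auto simp: desc_def)

lemma lev_desc: "w \<in> desc u \<Longrightarrow> w = u \<or> lev u < lev w"
  unfolding desc_def mem_Collect_eq by (induction rule: rtranclp_induct) (auto simp: child_def)

lemma desc_subset: "u \<in> V \<Longrightarrow> desc u \<subseteq> V"
proof
  fix w assume "u \<in> V" "w \<in> desc u"
  then show "w \<in> V" unfolding desc_def mem_Collect_eq by (metis child_in_V rtranclp.cases)
qed

lemma parent_in_desc:
  assumes "w \<in> desc u" "w \<noteq> u" "child z w"
  shows "z \<in> desc u"
  using assms unfolding desc_def mem_Collect_eq by (metis child_parent_unique rtranclp.cases)

text \<open>A common descendant strictly below this level is not \<open>v\<close>, so its parent is
  again a common descendant. Climbing ends at \<open>u\<close>, where the levels force
  equality.\<close>

lemma desc_disjoint: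
  assumes "w \<in> desc u" "w \<in> desc v" "lev u = lev v"
  shows "u = v"
  using assms unfolding desc_def [of u] mem_Collect_eq
proof (induction rule: rtranclp_induct)
  case base
  then show ?case using lev_desc by fastforce
next
  case (step y z)
  have "lev z > lev u" using step.hyps lev_desc [of z u] lev_desc [of y u] by (auto simp: desc_def child_def)
  then have "z \<noteq> v" using step.prems by auto
  then show ?case using step parent_in_desc by blast
qed

text \<open>Children of a member of \<open>desc c\<close> stay inside, and so does the parent of
  every member other than \<open>c\<close>.\<close>

lemma desc_boundary:
  assumes "w \<in> desc c" "z \<notin> desc c" "E z w"
  shows "w = c \<and> child z c"
proof -
  have "child z w \<or> child w z" using assms(3) E_lev E_sym by (auto simp: child_def)
  then have "child z w" using desc_child assms by blast
  then show ?thesis using parent_in_desc assms by blast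
qed

lemma desc_rt: "desc rt = V"
proof -
  have "v \<in> desc rt" if "v \<in> V" for v
    using that
  proof (induction "lev v" arbitrary: v rule: less_induct)
    case less
    show ?case
    proof (cases "v = rt")
      case False
      then obtain u where "child u v" using has_parent less.prems by (auto simp: child_def)
      then show ?thesis using less.hyps [of u] child_in_V desc_child by (auto simp: child_def)
    qed simp
  qed
  then show ?thesis using desc_subset rt_in_V by auto
qed

lemma desc_unfold: "desc u = {u} \<union> (\<Union>c\<in>Collect (child u). desc c)"
  unfolding desc_def by (auto intro: converse_rtranclp_into_rtranclp elim: converse_rtranclpE)

lemma finite_children: "finite (Collect (child u))"
  using finite_V by (rule finite_subset [rotated]) (auto dest: child_in_V)

lemma branches_subset_V: "u \<in> V \<Longrightarrow> C \<subseteq> Collect (child u) \<Longrightarrow> {u} \<union> (\<Union>c\<in>C. desc c) \<subseteq> V"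
  using desc_subset child_in_V by blast

lemma branches_disjoint:
  assumes "C \<subseteq> Collect (child u)" "child u c" "c \<notin> C"
  shows "({u} \<union> (\<Union>c\<in>C. desc c)) \<inter> desc c = {}"
proof -
  have "u \<notin> desc c" using lev_desc assms(2) by (fastforce simp: child_def)
  moreover have "desc d \<inter> desc c = {}" if "d \<in> C" for d
  proof -
    have "lev d = lev c" "d \<noteq> c" using that assms by (auto simp: child_def)
    then show ?thesis using desc_disjoint by blast
  qed
  ultimately show ?thesis by blast
qed

lemma branches_edge:
  assumes "x \<notin> desc c" "y \<in> desc c" "child u c"
  shows "E x y \<longleftrightarrow> x = u \<and> y = c"
  using assms desc_boundary child_parent_unique by (metis child_def)

text \<open>The branches are glued to \<open>u\<close> one at a time. \<open>C\<close> may omit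
  children, because the piece of a path vertex lacks the branch through which the path continues
  downwards.\<close>

lemma branch_polys:
  assumes u: "u \<in> V" and C: "C \<subseteq> Collect (child u)"
  shows "without_poly {} ({u} \<union> (\<Union>c\<in>C. desc c)) u
      = (\<Prod>c\<in>C. without_poly {} (desc c) c + with_poly {} (desc c) c) \<and>
    with_poly {} ({u} \<union> (\<Union>c\<in>C. desc c)) u = monom 1 1 * (\<Prod>c\<in>C. without_poly {} (desc c) c)"
  using finite_subset [OF C finite_children] C
proof (induction rule: finite_induct)
  case empty
  then show ?case using without_with_singleton [OF u] by simp
next
  case (insert c C)
  let ?S = "{u} \<union> (\<Union>c\<in>C. desc c)"
  have c: "child u c" and C: "C \<subseteq> Collect (child u)" using insert by auto
  have disj: "?S \<inter> desc c = {}" using branches_disjoint [OF C c] insert by blast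
  have eq: "{u} \<union> (\<Union>c\<in>insert c C. desc c) = ?S \<union> desc c" by auto
  have S: "?S \<subseteq> V" using branches_subset_V [OF u C] .
  have T: "desc c \<subseteq> V" using desc_subset child_in_V c by blast
  have e: "E x y \<longleftrightarrow> x = u \<and> y = c" if "x \<in> ?S" "y \<in> desc c" for x y
    using branches_edge [OF _ that(2) c] that disj by blast
  note g = glue_along_edge [OF S T disj empty_subsetI _ self_in_desc e]
  show ?case unfolding eq using g insert C by (simp add: mult_ac)
qed

end

section \<open>Perfect trees and the chain of pieces along a path to a leaf\<close>

locale perfect_levelled_tree = levelled_tree +
  fixes r H :: nat
  assumes lev_le: "v \<in> V \<Longrightarrow> lev v \<le> H"
    and card_children: "v \<in> V \<Longrightarrow> lev v < H \<Longrightarrow> card (Collect (child v)) = r"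
    and r_pos: "r > 0"
begin

lemma no_children: "lev v = H \<Longrightarrow> Collect (child v) = {}"
  using lev_le child_in_V by (fastforce simp: child_def)

lemma desc_polys:
  assumes "u \<in> V" "lev u + i = H"
  shows "without_poly {} (desc u) u = out_poly r i \<and> with_poly {} (desc u) u = in_poly r i"
  using assms
proof (induction i arbitrary: u)
  case 0
  then have leaf: "Collect (child u) = {}" by (intro no_children) simp
  show ?case unfolding desc_unfold [of u] leaf using without_with_singleton 0 by simp
next
  case (Suc i)
  have c: "without_poly {} (desc c) c = out_poly r i \<and> with_poly {} (desc c) c = in_poly r i"
    if "c \<in> Collect (child u)" for c
    using that Suc child_in_V by (auto simp: child_def)
  have card: "card (Collect (child u)) = r" using Suc.prems card_children by simp
  show ?case
    using branch_polys [OF Suc.prems(1) subset_refl] c card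
    unfolding desc_unfold [of u] by simp
qed

text \<open>The polynomials \<open>a\<^sub>i\<close> and \<open>b\<^sub>i\<close> of the path vertex at height \<open>i\<close>, whose piece consists of that
  vertex and \<open>r - 1\<close> perfect subtrees.\<close>
fun side_out :: "nat \<Rightarrow> int poly" where
  "side_out 0 = 1"
| "side_out (Suc i) = (out_poly r i + in_poly r i) ^ (r - 1)"

fun side_in :: "nat \<Rightarrow> int poly" where
  "side_in 0 = monom 1 1"
| "side_in (Suc i) = monom 1 1 * out_poly r i ^ (r - 1)"

text \<open>Paths are indexed upwards from the leaf, so that the index of a vertex is its
  height.\<close>

definition leaf_path :: "(nat \<Rightarrow> 'a) \<Rightarrow> nat \<Rightarrow> bool" where
  "leaf_path p j \<longleftrightarrow> p 0 \<in> V \<and> lev (p 0) = H \<and> (\<forall>i<j. child (p (Suc i)) (p i))"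

lemma leaf_path_lev:
  assumes "leaf_path p j" "i \<le> j"
  shows "p i \<in> V" "lev (p i) + i = H"
  using assms(2)
proof (induction i)
  case (Suc i)
  { case 1 then show ?case using assms child_in_V [of "p (Suc i)" "p i"] by (auto simp: leaf_path_def) }
  { case 2 then show ?case using assms Suc by (force simp: leaf_path_def child_def) }
qed (use assms in \<open>auto simp: leaf_path_def\<close>)

text \<open>\<open>S\<close> is left open for two uses: \<open>p j\<close> with its other branches,
  and the whole tree outside \<open>desc (p i)\<close>.\<close>

lemma glue_leaf_path:
  assumes p: "leaf_path p j" and j: "j = Suc i" and S: "S \<subseteq> V" "desc (p i) \<inter> S = {}" "p j \<in> S"
    and F: "F \<subseteq> desc (p i)"
  shows "without_poly F (S \<union> desc (p i)) (p j)
      = without_poly {} S (p j) * (without_poly F (desc (p i)) (p i) + with_poly F (desc (p i)) (p i))"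
    and "with_poly F (S \<union> desc (p i)) (p j) = with_poly {} S (p j) * without_poly F (desc (p i)) (p i)"
proof -
  have c: "child (p j) (p i)" using p j by (auto simp: leaf_path_def)
  have T: "desc (p i) \<subseteq> V" using desc_subset child_in_V c by blast
  have "E x y \<longleftrightarrow> x = p j \<and> y = p i" if "x \<in> S" "y \<in> desc (p i)" for x y
    using branches_edge [OF _ that(2) c] that S by blast
  note g = glue_along_edge [OF S(1) T _ F S(3) self_in_desc this]
  show "without_poly F (S \<union> desc (p i)) (p j)
      = without_poly {} S (p j) * (without_poly F (desc (p i)) (p i) + with_poly F (desc (p i)) (p i))"
    "with_poly F (S \<union> desc (p i)) (p j) = with_poly {} S (p j) * without_poly F (desc (p i)) (p i)"
    using g S by (auto simp: Int_commute)
qed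

lemma leaf_path_start_in_desc:
  assumes "leaf_path p j" "i \<le> j"
  shows "p 0 \<in> desc (p i)"
  using assms(2)
proof (induction i)
  case (Suc i)
  then have "desc (p i) \<subseteq> desc (p (Suc i))"
    using assms desc_unfold [of "p (Suc i)"] by (auto simp: leaf_path_def)
  then show ?case using Suc by auto
qed simp

text \<open>Each step glues on the next path vertex with its \<open>r - 1\<close> branches off the
  path. Prescribing the leaf \<open>p 0\<close> amounts to setting the initial \<open>a 0\<close> to
  0.\<close>

lemma chain_polys:
  assumes p: "leaf_path p j" and "i \<le> j" and F: "F \<subseteq> {p 0}"
  shows "without_poly F (desc (p i)) (p i) = chain_out (side_out(0 := (if F = {} then 1 else 0))) side_in i \<and>
    with_poly F (desc (p i)) (p i) = chain_in (side_out(0 := (if F = {} then 1 else 0))) side_in i"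
  using assms(2)
proof (induction i)
  case 0
  have "desc (p 0) = {p 0}" using p no_children desc_unfold [of "p 0"] by (auto simp: leaf_path_def)
  then show ?case using without_with_singleton [of "p 0"] F p by (auto simp: leaf_path_def subset_singleton_iff)
next
  case (Suc i)
  let ?u = "p (Suc i)" and ?C = "Collect (child (p (Suc i))) - {p i}"
  let ?S = "{?u} \<union> (\<Union>c\<in>?C. desc c)"
  have c: "child ?u (p i)" and pi: "leaf_path p (Suc i)" using Suc.prems p by (auto simp: leaf_path_def)
  note lv = leaf_path_lev [OF p Suc.prems]
  have eq: "desc ?u = ?S \<union> desc (p i)" using desc_unfold [of ?u] c by auto
  have S: "?S \<subseteq> V" by (rule branches_subset_V [OF lv(1)]) auto
  have disj: "desc (p i) \<inter> ?S = {}" using branches_disjoint [of ?C ?u "p i"] c by blast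
  have "F \<subseteq> desc (p i)" using F leaf_path_start_in_desc [OF p, of i] Suc.prems by auto
  note g = glue_leaf_path [OF pi refl S disj _ this]
  have card: "card ?C = r - 1"
    using c lv card_children [of ?u] finite_children by (simp add: card_Diff_singleton)
  have d: "without_poly {} (desc d) d = out_poly r i \<and> with_poly {} (desc d) d = in_poly r i" if "d \<in> ?C" for d
    using that lv child_in_V by (intro desc_polys) (auto simp: child_def)
  have "without_poly {} ?S ?u = side_out (Suc i)" "with_poly {} ?S ?u = side_in (Suc i)"
    using branch_polys [OF lv(1), of ?C] d card by auto
  then show ?case unfolding eq using g Suc by simp
qed

text \<open>The path from \<open>l\<close> up to the root has pieces that exhaust the tree, and
  their polynomials depend on heights only; hence all leaves have the same star polynomial.\<close>

lemma leaf_star_poly: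
  assumes "l \<in> V" "lev l = H"
  shows "set_poly {A \<in> indep V. l \<in> A} = chain_out (side_out(0 := 0)) side_in H + chain_in (side_out(0 := 0)) side_in H"
proof -
  have "\<exists>p. leaf_path p k \<and> p 0 = l" if "k \<le> H" for k
    using that
  proof (induction k)
    case 0
    show ?case using assms by (auto simp: leaf_path_def intro: exI [of _ "\<lambda>_. l"])
  next
    case (Suc k)
    then obtain p where p: "leaf_path p k" "p 0 = l" by auto
    note lv = leaf_path_lev [OF p(1) le_refl]
    have "p k \<noteq> rt" using lv Suc.prems lev_rt by auto
    then obtain u where "child u (p k)" using has_parent lv by (auto simp: child_def)
    then have "leaf_path (p(Suc k := u)) (Suc k)" using p by (auto simp: leaf_path_def less_Suc_eq)
    moreover have "(p(Suc k := u)) 0 = l" using p by simp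
    ultimately show ?case by blast
  qed
  then obtain p where p: "leaf_path p H" "p 0 = l" by auto
  have "lev (p H) = 0" using leaf_path_lev [OF p(1) le_refl] by simp
  then have "p H = rt" using has_parent leaf_path_lev(1) [OF p(1) le_refl] by fastforce
  then show ?thesis
    using chain_polys [OF p(1) le_refl, of "{l}"] without_plus_with [of V "{l}" rt] p desc_rt by simp
qed

lemma exists_leaf_path:
  assumes "v \<in> V" "lev v + j = H"
  shows "\<exists>p. leaf_path p j \<and> p j = v"
  using assms
proof (induction j arbitrary: v)
  case 0
  then show ?case by (auto simp: leaf_path_def intro: exI [of _ "\<lambda>_. v"])
next
  case (Suc j)
  then have "card (Collect (child v)) > 0" using card_children r_pos by simp
  then obtain c where c: "child v c" by (metis card.empty empty_Collect_eq less_irrefl)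
  then obtain p where "leaf_path p j" "p j = c" using Suc child_in_V by (force simp: child_def)
  then have "leaf_path (p(Suc j := v)) (Suc j)" using c by (auto simp: leaf_path_def less_Suc_eq)
  then show ?case by (metis fun_upd_same)
qed

text \<open>The pieces below \<open>p j\<close> are perfect, while the last piece \<open>S\<close>
  is all of the tree outside \<open>desc (p i)\<close>. Of \<open>S\<close> only
  \<open>with_le_without\<close> and nonnegativity enter \<open>chain_ends_compare\<close>; the
  interior sign condition comes from \<open>root_odds_alternate\<close> with exponent
  \<open>r - 1\<close>.\<close>

lemma star_poly_le_leaf:
  assumes p: "leaf_path p j" and j: "j = Suc i"
  shows "nonneg_poly (set_poly {A \<in> indep V. p 0 \<in> A} - set_poly {A \<in> indep V. p j \<in> A})"
proof -
  define S where "S = V - desc (p i)"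
  have c: "child (p j) (p i)" using p j by (auto simp: leaf_path_def)
  have "p j \<notin> desc (p i)" using lev_desc c by (fastforce simp: child_def)
  then have S: "S \<subseteq> V" "desc (p i) \<inter> S = {}" "p j \<in> S" and V: "V = S \<union> desc (p i)"
    using c child_in_V desc_subset by (auto simp: S_def)
  have p0: "p 0 \<in> desc (p i)" using leaf_path_start_in_desc [OF p] j by simp
  define a b where "a = side_out(j := without_poly {} S (p j))" and "b = side_in(j := with_poly {} S (p j))"
  have ab: "a (Suc n) = (out_poly r n + in_poly r n) ^ (r - 1)" "b (Suc n) = monom 1 1 * out_poly r n ^ (r - 1)"
    if "Suc n < j" for n
    using that by (auto simp: a_def b_def)
  have ab0: "a 0 = 1" "b 0 = monom 1 1" using j by (auto simp: a_def b_def)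
  have chain: "without_poly F V (p j) = chain_out (a(0 := (if F = {} then 1 else 0))) b j
      \<and> with_poly F V (p j) = chain_in (a(0 := (if F = {} then 1 else 0))) b j" if "F \<subseteq> {p 0}" for F
  proof -
    let ?e = "if F = {} then 1 else 0 :: int poly"
    have *: "chain_out (side_out(0 := ?e)) side_in i = chain_out (a(0 := ?e)) b i
       \<and> chain_in (side_out(0 := ?e)) side_in i = chain_in (a(0 := ?e)) b i"
      by (rule chain_out_in_cong) (use j in \<open>auto simp: a_def b_def\<close>)
    have "F \<subseteq> desc (p i)" using that p0 by blast
    note g = glue_leaf_path [OF p j S this, folded V]
    show ?thesis using g chain_polys [OF p _ that, of i] * j by (simp add: a_def b_def)
  qed
  have l: "set_poly {A \<in> indep V. p 0 \<in> A} = chain_out (a(0 := 0)) b j + chain_in (a(0 := 0)) b j"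
    using chain [of "{p 0}"] without_plus_with [of V "{p 0}" "p j"] by simp
  have a1: "a(0 := 1) = a" using ab0 by auto
  have "set_poly {A \<in> indep V. p j \<in> A} = with_poly {} V (p j)" by (simp add: with_poly_def)
  also have "\<dots> = chain_in a b j" using chain [of "{}"] a1 by simp
  \<comment> \<open>The entry \<open>a j\<close> occurs only in \<open>chain_out a b j\<close>, so
    setting it to 0 removes that summand and keeps \<open>chain_in\<close>.\<close>
  also have "\<dots> = chain_in (a(j := 0)) b j"
    using chain_out_in_cong [of i a "a(j := 0)" b b] j by simp
  also have "\<dots> = chain_out (a(j := 0)) b j + chain_in (a(j := 0)) b j" using j by simp
  finally have v: "set_poly {A \<in> indep V. p j \<in> A} = chain_out (a(j := 0)) b j + chain_in (a(j := 0)) b j" .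
  have nn: "nonneg_poly (out_poly r n)" "nonneg_poly (in_poly r n)" for n
    using nonneg_out_poly nonneg_in_poly by auto
  show ?thesis unfolding l v
  proof (rule chain_ends_compare)
    show "j > 0" using j by simp
    show "nonneg_poly (a n)" for n
      by (cases n) (auto simp: a_def without_poly_def nonneg_set_poly intro!: nonneg_poly_power nonneg_poly_add nn)
    show "nonneg_poly (b n)" for n
      by (cases n) (auto simp: b_def with_poly_def nonneg_set_poly
          intro!: nonneg_poly_mult nonneg_poly_monom nonneg_poly_power nn)
    show "nonneg_poly (b 0 * a j - a 0 * b j)"
      using with_le_without [OF S(1)] by (simp add: ab0) (simp add: a_def b_def)
    fix n assume n: "Suc n \<le> j - Suc n"
    \<comment> \<open>The branches at the path vertex \<open>Suc n\<close> have height
      \<open>n\<close>, and those at the opposite vertex \<open>j - Suc n = Suc m\<close> have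
      height \<open>m\<close>.\<close>
    define m where "m = j - Suc (Suc n)"
    have m: "j - Suc n = Suc m" "n \<le> m" "Suc m < j" "Suc n < j" using n by (auto simp: m_def)
    have "nonneg_poly (monom 1 1 * ((- 1) ^ n * ((out_poly r n + in_poly r n) ^ (r - 1) * out_poly r m ^ (r - 1)
       - (out_poly r m + in_poly r m) ^ (r - 1) * out_poly r n ^ (r - 1))))"
      by (intro nonneg_poly_mult [OF nonneg_poly_monom] root_odds_alternate m) simp
    then show "nonneg_poly ((- 1) ^ n * (a (Suc n) * b (j - Suc n) - a (j - Suc n) * b (Suc n)))"
      unfolding m ab [OF m(3)] ab [OF m(4)] by (simp add: algebra_simps)
  qed
qed

theorem card_star_le_leaf_star:
  assumes "v \<in> V" "l \<in> V" "lev l = H"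
  shows "card {A \<in> indep V. v \<in> A \<and> card A = k} \<le> card {A \<in> indep V. l \<in> A \<and> card A = k}"
proof -
  have "lev v + (H - lev v) = H" using lev_le assms by simp
  then obtain p where p: "leaf_path p (H - lev v)" "p (H - lev v) = v"
    using exists_leaf_path assms by blast
  have leaf: "p 0 \<in> V" "lev (p 0) = H" using p by (auto simp: leaf_path_def)
  have "nonneg_poly (set_poly {A \<in> indep V. p 0 \<in> A} - set_poly {A \<in> indep V. v \<in> A})"
  proof (cases "H - lev v")
    case 0
    then show ?thesis using p by simp
  next
    case (Suc i)
    then show ?thesis using star_poly_le_leaf [OF p(1) Suc] p by simp
  qed
  \<comment> \<open>The leaf below \<open>v\<close> is exchanged for \<open>l\<close>, which has the
    same star polynomial.\<close>
  then have "nonneg_poly (set_poly {A \<in> indep V. l \<in> A} - set_poly {A \<in> indep V. v \<in> A})"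
    using leaf_star_poly leaf assms by simp
  then have "coeff (set_poly {A \<in> indep V. v \<in> A}) k \<le> coeff (set_poly {A \<in> indep V. l \<in> A}) k"
    by (simp add: nonneg_poly_def)
  then show ?thesis using finite_indep [OF subset_refl] by (simp add: coeff_set_poly conj_assoc)
qed

end

section \<open>Levels in acyclic graphs\<close>

text \<open>The distance as a natural number, which permits induction; it is meaningful only if some
  walk exists.\<close>

definition (in pre_digraph) level :: "'a \<Rightarrow> 'a \<Rightarrow> nat" where
  "level u v = (LEAST n. \<exists>p. awalk u p v \<and> length p = n)"

context graph
begin

text \<open>The closing arc repeats only the start vertex. Length at least 2 rules out the 2-cycle
  formed by an edge and its reverse.\<close>

lemma apath_closing_cycle:
  assumes p: "apath u p v" and len: "length p \<ge> 2" and e: "v \<rightarrow> u"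
  shows "\<exists>c. cycle c \<and> length c \<ge> 3"
proof -
  obtain a where a: "a \<in> arcs G" "tail G a = v" "head G a = u" using e by blast
  have w: "awalk u p v" and d: "distinct (awalk_verts u p)" using p by (auto simp: apath_def)
  have av: "awalk v [a] u" using a by (auto simp: awalk_simps)
  have "awalk_verts u p = u # tl (awalk_verts u p)"
    using w by (metis awhd_of_awalk awalk_verts_non_Nil list.collapse)
  moreover have "awalk_verts u (p @ [a]) = awalk_verts u p @ [u]"
    using awalk_verts_append [OF awalk_appendI [OF w av]] w a by simp
  ultimately have "distinct (tl (awalk_verts u (p @ [a])))"
    using d by (metis distinct_append distinct1_rotate list.sel(3) rotate1.simps(2) tl_append2 append_Cons)
  then have "cycle (p @ [a])" using awalk_appendI [OF w av] by (auto simp: cycle_def)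
  then show ?thesis using len by (intro exI [of _ "p @ [a]"]) simp
qed

lemma level_le: "awalk u p v \<Longrightarrow> level u v \<le> length p"
  unfolding level_def by (rule Least_le) auto

lemma shortest_awalk:
  assumes "u \<rightarrow>\<^sup>* v"
  obtains p where "awalk u p v" "length p = level u v"
proof -
  obtain p where "awalk u p v" using assms reachable_awalk by blast
  then have "\<exists>n p. awalk u p v \<and> length p = n" by blast
  from LeastI_ex [OF this, folded level_def] show thesis using that by blast
qed

text \<open>With unit costs the infimum over walks is attained by a shortest walk.\<close>

lemma hop_dist_level:
  assumes "u \<rightarrow>\<^sup>* v"
  shows "hop_dist G u v = ereal (real (level u v))"
proof -
  have cost: "awalk_cost (\<lambda>_. 1) p = real (length p)" for p :: "'b awalk"
    by (induction p) auto
  obtain p where p: "awalk u p v" "length p = level u v" using shortest_awalk assms .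
  show ?thesis unfolding hop_dist_def \<mu>_def cost
  proof (rule antisym)
    show "(INF p\<in>{p. awalk u p v}. ereal (real (length p))) \<le> ereal (real (level u v))"
      using p by (auto intro!: INF_lower2 [of p])
    show "ereal (real (level u v)) \<le> (INF p\<in>{p. awalk u p v}. ereal (real (length p)))"
      by (rule INF_greatest) (auto intro: level_le)
  qed
qed

end

locale acyclic_rooted_graph = graph G for G :: "('a, 'b) pre_digraph" (structure) +
  fixes rt :: 'a
  assumes reach: "v \<in> verts G \<Longrightarrow> rt \<rightarrow>\<^sup>* v"
    and no_cycle: "cycle c \<Longrightarrow> length c < 3"
    and rt: "rt \<in> verts G"
begin

abbreviation lev :: "'a \<Rightarrow> nat" where "lev \<equiv> level rt"

lemma lev_rt: "lev rt = 0"
  using level_le [of rt "[]" rt] rt by (simp add: awalk_simps)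

lemma lev_arc:
  assumes "u \<rightarrow> v"
  shows "lev v \<le> Suc (lev u)"
proof -
  obtain a where a: "a \<in> arcs G" "tail G a = u" "head G a = v" using assms by blast
  then have "u \<in> verts G" by auto
  from shortest_awalk [OF reach [OF this]]
  obtain p where p: "awalk rt p u" "length p = lev u" .
  have "awalk u [a] v" using a by (auto simp: awalk_simps)
  from level_le [OF awalk_appendI [OF p(1) this]] show ?thesis using p(2) by simp
qed

lemma lev_parent:
  assumes "v \<in> verts G" "v \<noteq> rt"
  shows "\<exists>u. u \<rightarrow> v \<and> lev v = Suc (lev u)"
proof -
  obtain p where p: "awalk rt p v" "length p = lev v" using shortest_awalk [OF reach [OF assms(1)]] .
  have "p \<noteq> []" using p assms by (auto simp: awalk_simps)
  then obtain q a where q: "p = q @ [a]" by (metis rev_exhaust)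
  have w: "awalk rt q (tail G a)" "a \<in> arcs G" "head G a = v" using p q by (auto simp: awalk_simps)
  then have "tail G a \<rightarrow> v" using in_arcs_imp_in_arcs_ends by blast
  moreover have "lev (tail G a) \<le> length q" using w level_le by blast
  ultimately show ?thesis using lev_arc [of "tail G a" v] p q by (intro exI [of _ "tail G a"]) auto
qed

lemma lev_eq_0: "v \<in> verts G \<Longrightarrow> lev v = 0 \<Longrightarrow> v = rt"
  using lev_parent [of v] by auto

lemma no_closing_apath:
  assumes "apath u p v" "length p \<ge> 2"
  shows "\<not> v \<rightarrow> u"
proof
  assume "v \<rightarrow> u"
  from apath_closing_cycle [OF assms this] obtain c where "cycle c" "length c \<ge> 3" by blast
  then show False using no_cycle [of c] by simp
qed

text \<open>Climb from \<open>u\<close> and \<open>v\<close> to their parents, which coincide or are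
  joined by the induction hypothesis. All inner vertices are nearer to the root than level
  \<open>n\<close>, so adding the two ends creates no repetition.\<close>

lemma apath_below:
  assumes "u \<in> verts G" "v \<in> verts G" "lev u = n" "lev v = n" "u \<noteq> v"
  shows "\<exists>p. apath u p v \<and> length p \<ge> 2 \<and> (\<forall>w\<in>set (awalk_verts u p). w = u \<or> w = v \<or> lev w < n)"
  using assms
proof (induction n arbitrary: u v)
  case 0
  then show ?case using lev_eq_0 [of u] lev_eq_0 [of v] by simp
next
  case (Suc n)
  have "u \<noteq> rt" "v \<noteq> rt" using Suc.prems lev_rt by auto
  then obtain u' v' where u': "u' \<rightarrow> u" "lev u' = n" and v': "v' \<rightarrow> v" "lev v' = n"
    using lev_parent [OF Suc.prems(1)] lev_parent [OF Suc.prems(2)] Suc.prems by auto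
  have "u \<rightarrow> u'" using arcs_ends_symmetric [OF sym_arcs u'(1)] .
  then obtain a b where a: "a \<in> arcs G" "tail G a = u" "head G a = u'"
    and b: "b \<in> arcs G" "tail G b = v'" "head G b = v" using v' by blast
  then have verts: "u' \<in> verts G" "v' \<in> verts G" by auto
  obtain q where q: "apath u' q v'" "\<forall>w\<in>set (awalk_verts u' q). lev w < Suc n"
  proof (cases "u' = v'")
    case True
    then show ?thesis using that [of "[]"] verts u' by (simp add: apath_simps)
  next
    case False
    then obtain q where "apath u' q v'" and
        below: "\<forall>w\<in>set (awalk_verts u' q). w = u' \<or> w = v' \<or> lev w < n"
      using Suc.IH [of u' v'] verts u' v' by auto
    moreover have "lev w < Suc n" if "w \<in> set (awalk_verts u' q)" for w
      using bspec [OF below that] u'(2) v'(2) by auto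
    ultimately show ?thesis using that by blast
  qed
  have w: "awalk u' q v'" "awalk v' [b] v" using q b by (auto simp: apath_def awalk_simps)
  have V: "awalk_verts u (a # q @ [b]) = u # awalk_verts u' q @ [v]"
    using awalk_verts_append [OF awalk_appendI [OF w]] w a b by simp
  have "awalk u (a # q @ [b]) v" using awalk_appendI [OF w] a by (auto simp: awalk_Cons_iff)
  moreover have "distinct (awalk_verts u (a # q @ [b]))"
    unfolding V using q Suc.prems by (auto simp: apath_def)
  ultimately have "apath u (a # q @ [b]) v" unfolding apath_def by blast
  moreover have "length (a # q @ [b]) \<ge> 2" by simp
  moreover have "\<forall>w\<in>set (awalk_verts u (a # q @ [b])). w = u \<or> w = v \<or> lev w < Suc n"
    unfolding V using q by auto
  ultimately show ?case by (intro exI [of _ "a # q @ [b]"] conjI)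
qed

text \<open>Levels of neighbours differ by at most one, and an edge within a level would close the
  path of \<open>apath_below\<close> to a cycle.\<close>

lemma lev_arc_cases:
  assumes "u \<rightarrow> v"
  shows "lev u = Suc (lev v) \<or> lev v = Suc (lev u)"
proof -
  have "v \<rightarrow> u" using arcs_ends_symmetric [OF sym_arcs assms] .
  moreover have "u \<noteq> v" using assms adj_not_same by blast
  moreover have "u \<in> verts G" "v \<in> verts G" using assms by auto
  ultimately have "lev u \<noteq> lev v" using apath_below [of u v "lev u"] no_closing_apath [of u _ v] by metis
  then show ?thesis using lev_arc [OF assms] lev_arc [OF \<open>v \<rightarrow> u\<close>] by auto
qed

text \<open>Two parents would be joined by a path of \<open>apath_below\<close>; \<open>w\<close>
  lies deeper than that path and closes it to a cycle.\<close>

lemma lev_parent_unique: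
  assumes "u \<rightarrow> w" "v \<rightarrow> w" "lev w = Suc (lev u)" "lev w = Suc (lev v)"
  shows "u = v"
proof (rule ccontr)
  assume "u \<noteq> v"
  moreover have "u \<in> verts G" "v \<in> verts G" using assms by auto
  ultimately obtain p where p: "apath u p v" "length p \<ge> 2"
      "\<forall>x\<in>set (awalk_verts u p). x = u \<or> x = v \<or> lev x < lev u"
    using apath_below [of u v "lev u"] assms by auto
  have "w \<rightarrow> u" using arcs_ends_symmetric [OF sym_arcs assms(1)] .
  then obtain a where "a \<in> arcs G" "tail G a = w" "head G a = u" by blast
  moreover have "w \<notin> set (awalk_verts u p)" using p assms by fastforce
  ultimately have "apath w (a # p) v" using p by (auto simp: apath_Cons_iff)
  then show False using no_closing_apath [of w "a # p" v] p assms by auto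
qed

end

section \<open>From the graph definition of perfect trees to levels\<close>

lemma perfect_tree_acyclic_rooted_graph:
  assumes "perfect_tree r h T rt"
  shows "acyclic_rooted_graph T rt"
proof -
  have T: "graph T" "connected T" "rt \<in> verts T" and c: "\<not> (\<exists>p. pre_digraph.cycle T p \<and> length p \<ge> 3)"
    using assms unfolding perfect_tree_def undirected_tree_def by blast+
  interpret graph T by (rule T(1))
  have "strongly_connected T" using symmetric_connected_imp_strongly_connected [OF sym_arcs T(2)] .
  then have "rt \<rightarrow>\<^sup>*\<^bsub>T\<^esub> v" if "v \<in> verts T" for v
    using that T(3) by (simp add: strongly_connected_def)
  moreover have "length p < 3" if "cycle p" for p using that c by (simp add: not_le)
  ultimately show ?thesis using T(3) by unfold_locales
qed

lemma perfect_tree_perfect_levelled_tree: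
  assumes r: "r > 0" and T: "perfect_tree r h T rt"
  shows "perfect_levelled_tree (verts T) (dominates T) (pre_digraph.level T rt) rt r (h - 1)"
    and "leaves T rt = {v \<in> verts T. pre_digraph.level T rt v = h - 1}"
proof -
  interpret acyclic_rooted_graph T rt by (rule perfect_tree_acyclic_rooted_graph [OF T])
  interpret levelled_tree "verts T" "dominates T" "level rt" rt
  proof
    show "finite (verts T)" by simp
    show "v \<rightarrow>\<^bsub>T\<^esub> u" if "u \<rightarrow>\<^bsub>T\<^esub> v" for u v using arcs_ends_symmetric [OF sym_arcs that] .
    show "\<not> u \<rightarrow>\<^bsub>T\<^esub> u" for u using adj_not_same by blast
    show "u \<in> verts T" if "u \<rightarrow>\<^bsub>T\<^esub> v" for u v using that by auto
  qed (use lev_arc_cases lev_parent_unique rt lev_rt lev_parent in \<open>blast+\<close>)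
  have dist: "hop_dist T rt v = ereal (real (level rt v))" if "v \<in> verts T" for v
    using hop_dist_level reach that by blast
  have ch: "children T rt v = Collect (child v)" if "v \<in> verts T" for v
    using that dist child_in_V by (auto simp: children_def child_def)
  have leaf: "level rt v = h - 1" if "v \<in> leaves T rt" for v
  proof -
    have "hop_dist T rt v = ereal (real (h - 1))" using T that unfolding perfect_tree_def by blast
    then show ?thesis using dist [of v] that by (simp add: leaves_def)
  qed
  have le: "level rt v \<le> h - 1" if "v \<in> verts T" for v
  proof -
    \<comment> \<open>A vertex of maximal level has no children, hence is a leaf and lies on level
      \<open>h - 1\<close>; this bounds all levels.\<close>
    have "Max (level rt ` verts T) \<in> level rt ` verts T" using that by (intro Max_in) auto
    then obtain w where "w \<in> verts T" "level rt w = Max (level rt ` verts T)" by auto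
    then have w: "w \<in> verts T" "level rt x \<le> level rt w" if "x \<in> verts T" for x
      using that by auto
    have "\<not> child w x" for x
      using w(2) [of x] child_in_V [of w x] by (auto simp: child_def)
    then have "w \<in> leaves T rt" using w(1) ch that by (simp add: leaves_def)
    then show ?thesis using leaf [of w] w(2) [OF that] by simp
  qed
  have "card (Collect (child v)) = r" if "v \<in> verts T" "level rt v < h - 1" for v
  proof -
    have "v \<notin> leaves T rt" using leaf [of v] that by auto
    then have "card (children T rt v) = r" using T that unfolding perfect_tree_def by blast
    then show ?thesis using ch that by simp
  qed
  then interpret perfect_levelled_tree "verts T" "dominates T" "level rt" rt r "h - 1"
    using r le by unfold_locales blast+
  show "perfect_levelled_tree (verts T) (dominates T) (level rt) rt r (h - 1)" by unfold_locales
  show "leaves T rt = {v \<in> verts T. level rt v = h - 1}"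
    using leaf ch no_children by (auto simp: leaves_def)
qed

theorem theorem1:
  fixes T :: "('a, 'b) pre_digraph" and rt v l :: 'a and r h k :: nat
  assumes "r \<ge> 2" and "h \<ge> 1"
    and "perfect_tree r h T rt"
    and "k \<ge> 1"
    and "v \<in> verts T"
    and "l \<in> leaves T rt"
  shows "card (indep_star T k v) \<le> card (indep_star T k l)"
proof -
  have r: "r > 0" using assms by simp
  interpret perfect_levelled_tree "verts T" "dominates T" "pre_digraph.level T rt" rt r "h - 1"
    using perfect_tree_perfect_levelled_tree(1) [OF r assms(3)] .
  have star: "indep_star T k u = {A \<in> indep (verts T). u \<in> A \<and> card A = k}" for u
    by (auto simp: indep_star_def indep_sets_of_size_def independent_set_def indep_def)
  have "l \<in> verts T" "pre_digraph.level T rt l = h - 1"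
    using perfect_tree_perfect_levelled_tree(2) [OF r assms(3)] assms(6) by auto
  then show ?thesis unfolding star using card_star_le_leaf_star assms(5) by blast
qed

end
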